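(* For every $p\in\mathbb{N}$, the class of $(P_7,K_{p,p}+O_{0,p})$-free bipartite graphs is at most factorial.
   Context: Graphs are finite, simple and undirected; $\mathbb{N}$ denotes the positive integers. Every bipartite graph is given together with a bipartition of its vertex set into two independent sets (parts). A bipartite graph $G$ contains a bipartite graph $H$ as an induced subgraph if there is an induced copy of $H$ in $G$ in which the two parts of $H$ are mapped into the two different parts of $G$ (it is not specified which part of $H$ goes to which part of $G$); $G$ is $(H_1,H_2)$-free if it contains neither $H_1$ nor $H_2$ as an induced subgraph. $P_7$ is the chordless path with 7 vertices. $K_{p,p}+O_{0,p}$ is the bipartite graph obtained from the complete bipartite graph $K_{p,p}$ by adding $p$ isolated vertices, all to the same part (so its parts have sizes $p$ and $2p$). A hereditary class (one closed under taking induced subgraphs) is at most factorial if the number of labelled graphs in it with vertex set $\{1,\ldots,n\}$ is $2^{O(n\log n)}$. *)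

theory Defs
  imports Complex_Main "HOL-Library.Landau_Symbols"
begin

text \<open>A bipartite graph carries an ordered pair of parts. All notions below except the count are
  invariant under swapping the parts, and the order changes the count by a factor of at most 2.\<close>

record 'a bigraph =
  lpart :: "'a set"
  rpart :: "'a set"
  edges :: "'a set set"

definition verts :: "'a bigraph \<Rightarrow> 'a set" where
  "verts G = lpart G \<union> rpart G"

definition independent :: "'a bigraph \<Rightarrow> 'a set \<Rightarrow> bool" where
  "independent G S \<longleftrightarrow> (\<forall>u\<in>S. \<forall>v\<in>S. {u, v} \<notin> edges G)"

definition bipartite_graph :: "'a bigraph \<Rightarrow> bool" where
  "bipartite_graph G \<longleftrightarrow>
     finite (verts G) \<and>
     edges G \<subseteq> {e. e \<subseteq> verts G \<and> card e = 2} \<and>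
     lpart G \<inter> rpart G = {} \<and>
     independent G (lpart G) \<and> independent G (rpart G)"

definition induced_subgraph :: "'a bigraph \<Rightarrow> 'a set \<Rightarrow> 'a bigraph" where
  "induced_subgraph G S =
     \<lparr>lpart = lpart G \<inter> S, rpart = rpart G \<inter> S, edges = {e \<in> edges G. e \<subseteq> S}\<rparr>"

definition contains_induced :: "'a bigraph \<Rightarrow> 'b bigraph \<Rightarrow> bool" where
  "contains_induced G H \<longleftrightarrow>
     (\<exists>f. inj_on f (verts H) \<and> f ` verts H \<subseteq> verts G \<and>
          (\<forall>u\<in>verts H. \<forall>v\<in>verts H. {f u, f v} \<in> edges G \<longleftrightarrow> {u, v} \<in> edges H) \<and>
          (f ` lpart H \<subseteq> lpart G \<and> f ` rpart H \<subseteq> rpart G \<or>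
           f ` lpart H \<subseteq> rpart G \<and> f ` rpart H \<subseteq> lpart G))"

definition path_bigraph :: "nat \<Rightarrow> nat bigraph" where
  "path_bigraph k =
     \<lparr>lpart = {i. i < k \<and> even i}, rpart = {i. i < k \<and> odd i},
      edges = {{i, Suc i} | i. Suc i < k}\<rparr>"

text \<open>\<open>K\<^bsub>p,p\<^esub> + O\<^bsub>0,p\<^esub>\<close>: the vertices \<open>2 * p, \<dots>, 3 * p - 1\<close> are isolated.\<close>

definition Kpp_plus_O0p :: "nat \<Rightarrow> nat bigraph" where
  "Kpp_plus_O0p p =
     \<lparr>lpart = {0..<p}, rpart = {p..<3 * p},
      edges = {{a, b} | a b. a \<in> {0..<p} \<and> b \<in> {p..<2 * p}}\<rparr>"

definition free_class :: "'b bigraph \<Rightarrow> 'c bigraph \<Rightarrow> 'a bigraph set" where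
  "free_class H1 H2 =
     {G. bipartite_graph G \<and> \<not> contains_induced G H1 \<and> \<not> contains_induced G H2}"

definition hereditary :: "'a bigraph set \<Rightarrow> bool" where
  "hereditary X \<longleftrightarrow> (\<forall>G\<in>X. \<forall>S\<subseteq>verts G. induced_subgraph G S \<in> X)"

definition labelled_graphs :: "nat bigraph set \<Rightarrow> nat \<Rightarrow> nat bigraph set" where
  "labelled_graphs X n = {G \<in> X. verts G = {1..n}}"

definition at_most_factorial :: "nat bigraph set \<Rightarrow> bool" where
  "at_most_factorial X \<longleftrightarrow>
     hereditary X \<and>
     (\<exists>f :: nat \<Rightarrow> real. f \<in> O(\<lambda>n. real n * ln (real n)) \<and>
        (\<forall>n\<ge>1. real (card (labelled_graphs X n)) \<le> 2 powr f n))"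

text \<open>Hence \<open>card\<close> in \<open>at_most_factorial\<close> is a genuine count for classes of bipartite graphs.\<close>

lemma finite_labelled_graphs:
  assumes "\<And>G. G \<in> X \<Longrightarrow> bipartite_graph G"
  shows "finite (labelled_graphs X n)"
proof (rule finite_subset)
  let ?P = "Pow {1..n}"
  show "labelled_graphs X n \<subseteq>
      (\<lambda>(A, B, E). \<lparr>lpart = A, rpart = B, edges = E\<rparr>) ` (?P \<times> ?P \<times> Pow ?P)"
  proof
    fix G assume "G \<in> labelled_graphs X n"
    then have "bipartite_graph G" and v: "verts G = {1..n}"
      using assms by (auto simp: labelled_graphs_def)
    then have "edges G \<subseteq> ?P" by (auto simp: bipartite_graph_def)
    moreover have "lpart G \<subseteq> {1..n}" "rpart G \<subseteq> {1..n}" using v by (auto simp: verts_def)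
    moreover have "G = \<lparr>lpart = lpart G, rpart = rpart G, edges = edges G\<rparr>" by simp
    ultimately show "G \<in> (\<lambda>(A, B, E). \<lparr>lpart = A, rpart = B, edges = E\<rparr>) ` (?P \<times> ?P \<times> Pow ?P)"
      by (intro image_eqI[where x = "(lpart G, rpart G, edges G)"]) auto
  qed
qed simp

end

theory Submission
  imports Defs "HOL-Library.Ramsey" "HOL-Library.FuncSet" "HOL-Real_Asymp.Real_Asymp"
begin

text \<open>A graph in the class is either sparse or the bipartite complement of a sparse graph, with
  linearly many edges or non-edges respectively, and there are only \<open>2\<^bsup>O(n log n)\<^esup>\<close> choices of
  linearly many pairs of labels.

  That all graphs in the class are sparse or co-sparse has two reasons. A graph without
  \<open>K\<^bsub>p,p\<^esub> + O\<^bsub>0,p\<^esub>\<close> cannot have both a large complete and a large empty pair of vertex sets from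
  different parts, by a Ramsey argument (\<open>biclique_dichotomy\<close>). As the bipartite complement of \<open>P\<^sub>7\<close> is
  \<open>P\<^sub>7\<close>, it remains to consider \<open>P\<^sub>7\<close>-free graphs without a large biclique, and these have a vertex of
  bounded degree (\<open>low_degree_vertex\<close>). Deleting such vertices one by one bounds the number of
  edges linearly (\<open>linear_number_of_pairs\<close>).

  The vertex of bounded degree is found as follows. Suppose that all degrees are large, and let \<open>v\<close>
  have minimum degree in its part \<open>A\<close>. As there is no large biclique, only few vertices of \<open>A\<close> are
  adjacent to a fixed fraction of the neighbourhood \<open>S\<close> of \<open>v\<close>. Each \<open>s\<close> in \<open>S\<close> thus has a
  neighbour that is adjacent to few vertices of \<open>S\<close>, and a greedy choice followed by Ramsey's
  theorem yields an induced matching of such pairs \<open>s i\<close>, \<open>W i\<close>. By the choice of \<open>v\<close>, each \<open>W i\<close> has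
  many neighbours outside \<open>S\<close>. These sets of outside neighbours cannot form a chain, as their
  smallest member would yield a biclique. So some \<open>W i\<close> and \<open>W j\<close> have outside neighbours \<open>x1\<close> and
  \<open>x2\<close> that they do not share, and \<open>x1, W i, s i, v, s j, W j, x2\<close> is an induced \<open>P\<^sub>7\<close>.\<close>

section \<open>Patterns in bipartite adjacency relations\<close>

definition has_biclique :: "nat \<Rightarrow> 'a set \<Rightarrow> 'b set \<Rightarrow> ('a \<Rightarrow> 'b \<Rightarrow> bool) \<Rightarrow> bool" where
  "has_biclique q A B R \<longleftrightarrow>
     (\<exists>X\<subseteq>A. \<exists>Y\<subseteq>B. card X = q \<and> card Y = q \<and> (\<forall>x\<in>X. \<forall>y\<in>Y. R x y))"

definition has_biclique_plus_isolated ::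
    "nat \<Rightarrow> 'a set \<Rightarrow> 'b set \<Rightarrow> ('a \<Rightarrow> 'b \<Rightarrow> bool) \<Rightarrow> bool" where
  "has_biclique_plus_isolated p A B R \<longleftrightarrow>
     (\<exists>X\<subseteq>A. \<exists>Y\<subseteq>B. \<exists>Z\<subseteq>B. card X = p \<and> card Y = p \<and> card Z = p \<and>
        (\<forall>x\<in>X. \<forall>y\<in>Y. R x y) \<and> (\<forall>x\<in>X. \<forall>z\<in>Z. \<not> R x z))"

text \<open>The path is \<open>x1 w1 s1 v s2 w2 x2\<close>, with three vertices in \<open>A\<close> and four in \<open>B\<close>. Distinctness
  of the vertices follows from their different adjacencies.\<close>

definition induces_P7 ::
    "'a set \<Rightarrow> 'b set \<Rightarrow> ('a \<Rightarrow> 'b \<Rightarrow> bool) \<Rightarrow> 'a \<Rightarrow> 'a \<Rightarrow> 'a \<Rightarrow>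
      'b \<Rightarrow> 'b \<Rightarrow> 'b \<Rightarrow> 'b \<Rightarrow> bool" where
  "induces_P7 A B R w1 v w2 x1 s1 s2 x2 \<longleftrightarrow>
     {w1, v, w2} \<subseteq> A \<and> {x1, s1, s2, x2} \<subseteq> B \<and>
     R w1 x1 \<and> R w1 s1 \<and> \<not> R w1 s2 \<and> \<not> R w1 x2 \<and>
     \<not> R v x1 \<and> R v s1 \<and> R v s2 \<and> \<not> R v x2 \<and>
     \<not> R w2 x1 \<and> \<not> R w2 s1 \<and> R w2 s2 \<and> R w2 x2"

definition has_P7 :: "'a set \<Rightarrow> 'b set \<Rightarrow> ('a \<Rightarrow> 'b \<Rightarrow> bool) \<Rightarrow> bool" where
  "has_P7 A B R \<longleftrightarrow> (\<exists>w1 v w2 x1 s1 s2 x2. induces_P7 A B R w1 v w2 x1 s1 s2 x2)"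

lemma has_P7_mono:
  assumes "has_P7 A B R" "A \<subseteq> A'" "B \<subseteq> B'"
  shows "has_P7 A' B' R"
proof -
  have "induces_P7 A' B' R w1 v w2 x1 s1 s2 x2"
    if "induces_P7 A B R w1 v w2 x1 s1 s2 x2" for w1 v w2 x1 s1 s2 x2
    using that assms(2,3) unfolding induces_P7_def by (simp add: subset_iff)
  with assms(1) show ?thesis unfolding has_P7_def by (elim exE) (intro exI)
qed

text \<open>The bipartite complement of \<open>P\<^sub>7\<close> is again \<open>P\<^sub>7\<close>: the path in the complement of
  \<open>x1 w1 s1 v s2 w2 x2\<close> is \<open>s2 w1 x2 v x1 w2 s1\<close>.\<close>

lemma has_P7_complement:
  assumes "has_P7 A B (\<lambda>a b. \<not> R a b)"
  shows "has_P7 A B R"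
proof -
  have "induces_P7 A B R w1 v w2 s2 x2 x1 s1"
    if "induces_P7 A B (\<lambda>a b. \<not> R a b) w1 v w2 x1 s1 s2 x2" for w1 v w2 x1 s1 s2 x2
    using that by (simp add: induces_P7_def)
  with assms show ?thesis unfolding has_P7_def by (elim exE) (intro exI)
qed

lemma has_biclique_mono:
  "has_biclique q A B R \<Longrightarrow> A \<subseteq> A' \<Longrightarrow> B \<subseteq> B' \<Longrightarrow> has_biclique q A' B' R"
  unfolding has_biclique_def by (elim exE conjE) (intro exI conjI, auto)

lemma has_bicliqueI:
  assumes "X \<subseteq> A" "Y \<subseteq> B" "q \<le> card X" "q \<le> card Y" "\<And>x y. x \<in> X \<Longrightarrow> y \<in> Y \<Longrightarrow> R x y"
  shows "has_biclique q A B R"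
proof -
  obtain X' where X': "X' \<subseteq> X" "card X' = q" using obtain_subset_with_card_n assms(3) by metis
  obtain Y' where Y': "Y' \<subseteq> Y" "card Y' = q"
    using obtain_subset_with_card_n assms(4) by metis
  have "X' \<subseteq> A" "Y' \<subseteq> B" "\<forall>x\<in>X'. \<forall>y\<in>Y'. R x y"
    using X'(1) Y'(1) assms by blast+
  with X'(2) Y'(2) show ?thesis unfolding has_biclique_def by blast
qed

lemma popular_value:
  assumes "f ` A \<subseteq> C" "finite A" "finite C" "C \<noteq> {}" "q * card C \<le> card A"
  shows "\<exists>c\<in>C. q \<le> card {a\<in>A. f a = c}"
proof -
  from pigeonhole_card[of f A C] assms obtain c where
    c: "c \<in> C" "card A \<le> card (f -` {c} \<inter> A) * card C" by blast
  have "f -` {c} \<inter> A = {a\<in>A. f a = c}" by auto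
  with c(2) assms(5) have "q * card C \<le> card {a\<in>A. f a = c} * card C"
    by (metis order.trans)
  moreover have "card C > 0" using assms by (simp add: card_gt_0_iff)
  ultimately have "q \<le> card {a\<in>A. f a = c}" by simp
  then show ?thesis using c by blast
qed

text \<open>Every vertex of \<open>A\<close> is joined in the same way to at least half of \<open>B\<close>; many vertices of \<open>A\<close>
  agree on the half and on the way.\<close>

lemma bipartite_ramsey:
  fixes R :: "'a \<Rightarrow> 'b \<Rightarrow> bool"
  assumes A: "card A = p * 4 ^ (p + 1)" and B: "card B = 2 * p" and p: "p \<ge> 1"
  shows "has_biclique p A B R \<or> has_biclique p A B (\<lambda>a b. \<not> R a b)"
proof -
  have fin: "finite A" "finite B" using assms by (auto intro: card_ge_0_finite)
  have maj: "\<exists>h. p \<le> card {b\<in>B. R a b = h}" for a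
  proof -
    have "{b\<in>B. R a b = True} \<union> {b\<in>B. R a b = False} = B" by auto
    moreover have "{b\<in>B. R a b = True} \<inter> {b\<in>B. R a b = False} = {}" by auto
    ultimately have "card {b\<in>B. R a b = True} + card {b\<in>B. R a b = False} = 2 * p"
      using B fin by (metis (no_types, lifting) card_Un_disjoint finite_Un)
    then have "p \<le> card {b\<in>B. R a b = True} \<or> p \<le> card {b\<in>B. R a b = False}" by linarith
    then show ?thesis by blast
  qed
  then obtain h where h: "\<And>a. p \<le> card {b\<in>B. R a b = h a}" by metis
  define f where "f = (\<lambda>a. ({b\<in>B. R a b = h a}, h a))"
  have "\<exists>c\<in>Pow B \<times> UNIV. p \<le> card {a\<in>A. f a = c}"
  proof (rule popular_value)
    show "p * card (Pow B \<times> (UNIV :: bool set)) \<le> card A"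
      using A B fin by (simp add: card_cartesian_product card_Pow power_mult)
  qed (use fin in \<open>auto simp: f_def\<close>)
  then obtain Y c where c: "Y \<subseteq> B" "p \<le> card {a\<in>A. f a = (Y, c)}" by auto
  then obtain a0 where "a0 \<in> A" "f a0 = (Y, c)"
    using p by (metis (mono_tags, lifting) Collect_empty_eq One_nat_def card.empty not_one_le_zero
        le_trans)
  then have Y: "p \<le> card Y" using h[of a0] by (auto simp: f_def)
  have "has_biclique p A B (\<lambda>a b. R a b = c)"
    by (rule has_bicliqueI[OF _ c(1) c(2) Y]) (auto simp: f_def)
  then show ?thesis by (cases c) auto
qed

text \<open>A large biclique with parts \<open>X1\<close>, \<open>Y1\<close> and a large empty pair \<open>X2\<close>, \<open>Y2\<close> cannot coexist:
  between \<open>X1\<close> and \<open>Y2\<close> there is a homogeneous pair with parts of size \<open>p\<close>. If it is empty, its part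
  in \<open>X1\<close> is complete to \<open>Y1\<close> and empty to a part of \<open>Y2\<close>. If it is complete, its part in \<open>Y2\<close> is
  complete to a part of \<open>X1\<close> and empty to \<open>X2\<close>. Both are the excluded pattern, in opposite
  orientations.\<close>

lemma biclique_dichotomy:
  fixes R :: "'a \<Rightarrow> 'b \<Rightarrow> bool"
  assumes p: "p \<ge> 1"
    and free: "\<not> has_biclique_plus_isolated p A B R"
      "\<not> has_biclique_plus_isolated p B A (\<lambda>b a. R a b)"
  defines "q \<equiv> p * 4 ^ (p + 1)"
  shows "\<not> has_biclique q A B R \<or> \<not> has_biclique q A B (\<lambda>a b. \<not> R a b)"
proof (rule ccontr)
  assume "\<not> ?thesis"
  then obtain X1 Y1 X2 Y2 where
    1: "X1 \<subseteq> A" "Y1 \<subseteq> B" "card X1 = q" "card Y1 = q" "\<forall>x\<in>X1. \<forall>y\<in>Y1. R x y" and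
    2: "X2 \<subseteq> A" "Y2 \<subseteq> B" "card X2 = q" "card Y2 = q" "\<forall>x\<in>X2. \<forall>y\<in>Y2. \<not> R x y"
    unfolding has_biclique_def by auto
  have "(2::nat) \<le> 4 ^ (p + 1)" by (rule order.trans[of _ "4 ^ 1"], simp, rule power_increasing) auto
  then have q: "2 * p \<le> q" "p \<le> q" unfolding q_def by (simp_all add: mult.commute)
  obtain Y1' where Y1': "Y1' \<subseteq> Y1" "card Y1' = p" using obtain_subset_with_card_n 1(4) q(2) by metis
  obtain X2' where X2': "X2' \<subseteq> X2" "card X2' = p" using obtain_subset_with_card_n 2(3) q(2) by metis
  obtain Z where Z: "Z \<subseteq> Y2" "card Z = 2 * p" using obtain_subset_with_card_n 2(4) q(1) by metis
  from bipartite_ramsey[of X1 p Z R] 1(3) Z(2) p q_def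
  consider "has_biclique p X1 Z R" | "has_biclique p X1 Z (\<lambda>a b. \<not> R a b)" by auto
  then show False
  proof cases
    case 1
    then obtain X Y where XY: "X \<subseteq> X1" "Y \<subseteq> Z" "card X = p" "card Y = p" "\<forall>x\<in>X. \<forall>y\<in>Y. R x y"
      unfolding has_biclique_def by auto
    have "has_biclique_plus_isolated p B A (\<lambda>b a. R a b)"
      unfolding has_biclique_plus_isolated_def
      by (rule exI[of _ Y], rule conjI, use XY Z 2 in blast,
          rule exI[of _ X], rule conjI, use XY \<open>X1 \<subseteq> A\<close> in blast,
          rule exI[of _ X2'], rule conjI, use X2' 2 in blast)
        (use XY X2' Z 2 in blast)
    with free show False by simp
  next
    case 2
    then obtain X Y where XY: "X \<subseteq> X1" "Y \<subseteq> Z" "card X = p" "card Y = p" "\<forall>x\<in>X. \<forall>y\<in>Y. \<not> R x y"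
      unfolding has_biclique_def by auto
    have "has_biclique_plus_isolated p A B R"
      unfolding has_biclique_plus_isolated_def
      by (rule exI[of _ X], rule conjI, use XY 1 in blast,
          rule exI[of _ Y1'], rule conjI, use Y1' 1 in blast,
          rule exI[of _ Y], rule conjI, use XY Z \<open>Y2 \<subseteq> B\<close> in blast)
        (use XY Y1' 1 in blast)
    with free show False by simp
  qed
qed

section \<open>Vertices of bounded degree\<close>

text \<open>Call \<open>w\<close> heavy if at least \<open>1 / M\<close> of \<open>S\<close> is adjacent to it. The bound on the number of heavy
  vertices is a double counting argument: \<open>2 * M * q\<close> of them send so many edges to \<open>S\<close> that a
  positive fraction of \<open>S\<close> has at least \<open>q\<close> neighbours among them, and many of those vertices of
  \<open>S\<close> have the same neighbourhood there.\<close>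

lemma many_heavy_imp_biclique:
  fixes R :: "'a \<Rightarrow> 'b \<Rightarrow> bool"
  assumes S: "finite S" "card S \<ge> t * 2 ^ t" and T: "card T = t" and t: "t = 2 * M * q"
    and pos: "M \<ge> 1" "q \<ge> 1"
    and heavy: "\<And>w. w \<in> T \<Longrightarrow> card S \<le> M * card {s\<in>S. R w s}"
  shows "has_biclique q T S R"
proof -
  have tpos: "t \<ge> 1" using t pos by simp
  then have finT: "finite T" using T by (intro card_ge_0_finite) simp
  define N where "N = (\<lambda>s. {w\<in>T. R w s})"
  define Good where "Good = {s\<in>S. q \<le> card (N s)}"
  have finG: "finite Good" using S by (simp add: Good_def)
  have Nt: "card (N s) \<le> t" for s
    unfolding N_def T[symmetric] by (rule card_mono) (use finT in auto)
  have "t * card S = (\<Sum>w\<in>T. card S)" using T by simp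
  also have "\<dots> \<le> (\<Sum>w\<in>T. M * card {s\<in>S. R w s})" by (rule sum_mono) (rule heavy)
  also have "\<dots> = M * (\<Sum>w\<in>T. \<Sum>s\<in>S. if R w s then 1 else 0)"
    using S by (simp add: sum_distrib_left sum.If_cases Int_def)
  also have "(\<Sum>w\<in>T. \<Sum>s\<in>S. if R w s then 1 else (0::nat)) = (\<Sum>s\<in>S. card (N s))"
    unfolding N_def by (subst sum.swap) (use finT in \<open>simp add: sum.If_cases Int_def\<close>)
  also have "(\<Sum>s\<in>S. card (N s)) \<le> (\<Sum>s\<in>S. (if s \<in> Good then t else 0) + q)"
    by (rule sum_mono) (use Nt in \<open>auto simp: Good_def intro: le_SucI trans_le_add1\<close>)
  also have "\<dots> = card Good * t + q * card S"
  proof -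
    have "S \<inter> Good = Good" by (auto simp: Good_def)
    then show ?thesis using S by (simp add: sum.distrib sum.If_cases)
  qed
  finally have "M * (2 * q * card S) \<le> M * (card Good * t + q * card S)"
    by (simp add: t algebra_simps)
  then have "2 * q * card S \<le> card Good * t + q * card S" using pos by simp
  then have "q * card S \<le> q * (2 * M * card Good)" by (simp add: t algebra_simps)
  then have "card S \<le> 2 * M * card Good" using pos by simp
  moreover have "2 * M * (q * 2 ^ t) = t * 2 ^ t" by (simp add: t)
  ultimately have "2 * M * (q * 2 ^ t) \<le> 2 * M * card Good" using S(2) by linarith
  then have G: "q * 2 ^ t \<le> card Good"
    unfolding mult_le_cancel1 using pos by linarith
  have "\<exists>Y\<in>Pow T. q \<le> card {s\<in>Good. N s = Y}"
    by (rule popular_value) (use finG finT G T in \<open>auto simp: N_def card_Pow\<close>)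
  then obtain Y where Y: "Y \<subseteq> T" "q \<le> card {s\<in>Good. N s = Y}" by auto
  then obtain s0 where "s0 \<in> Good" "N s0 = Y"
    using pos by (metis (mono_tags, lifting) Collect_empty_eq One_nat_def card.empty not_one_le_zero
        le_trans)
  then have "q \<le> card Y" by (auto simp: Good_def)
  show ?thesis
    by (rule has_bicliqueI[OF Y(1) _ \<open>q \<le> card Y\<close> Y(2)]) (auto simp: Good_def N_def)
qed

text \<open>Each \<open>g s\<close> contains at most \<open>1 / M\<close> of \<open>S\<close>, so that a greedy choice of up to \<open>M\<close> elements
  avoiding the sets of all earlier ones does not run out of candidates.\<close>

lemma scattered_sequence:
  fixes g :: "'b \<Rightarrow> 'b set"
  assumes S: "finite S" "S \<noteq> {}" and g: "\<And>s. s \<in> S \<Longrightarrow> M * card (g s \<inter> S) \<le> card S"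
    and "k \<le> M"
  shows "\<exists>f :: nat \<Rightarrow> 'b. (\<forall>i<k. f i \<in> S) \<and> (\<forall>j<k. \<forall>i<j. f j \<notin> g (f i))"
  using \<open>k \<le> M\<close>
proof (induction k)
  case (Suc k)
  then obtain f :: "nat \<Rightarrow> 'b" where f: "\<forall>i<k. f i \<in> S" "\<forall>j<k. \<forall>i<j. f j \<notin> g (f i)" by auto
  have cS: "card S > 0" using S by (simp add: card_gt_0_iff)
  have "card (\<Union>i<k. g (f i) \<inter> S) \<le> (\<Sum>i<k. card (g (f i) \<inter> S))"
    by (rule card_UN_le) simp
  then have "M * card (\<Union>i<k. g (f i) \<inter> S) \<le> (\<Sum>i<k. M * card (g (f i) \<inter> S))"
    by (simp add: sum_distrib_left[symmetric])
  also have "\<dots> \<le> (\<Sum>i<k. card S)" by (rule sum_mono) (use f g in auto)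
  also have "\<dots> < M * card S" using Suc.prems cS by simp
  finally have "card (\<Union>i<k. g (f i) \<inter> S) < card S" by simp
  then have "\<not> S \<subseteq> (\<Union>i<k. g (f i) \<inter> S)"
    using S by (metis (no_types, lifting) UN_least card_mono inf_le2 linorder_not_le rev_finite_subset)
  then obtain s where s: "s \<in> S" "\<forall>i<k. s \<notin> g (f i)" by auto
  show ?case
    by (rule exI[of _ "f(k := s)"]) (use f s in \<open>auto simp: less_Suc_eq\<close>)
qed simp

lemma split_nat_set:
  fixes I :: "nat set"
  assumes "card I = 2 * q" "q \<ge> 1"
  obtains L U where "L \<subseteq> I" "U \<subseteq> I" "card L = q" "card U = q" "\<And>i j. i \<in> L \<Longrightarrow> j \<in> U \<Longrightarrow> i < j"
proof -
  have fin: "finite I" using assms by (auto intro: card_ge_0_finite)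
  define l where "l = sorted_list_of_set I"
  have l: "set l = I" "distinct l" "sorted l" "length l = 2 * q"
    using fin assms by (auto simp: l_def)
  show ?thesis
  proof
    show "set (take q l) \<subseteq> I" "set (drop q l) \<subseteq> I"
      using l(1) set_take_subset set_drop_subset by metis+
    show "card (set (take q l)) = q" "card (set (drop q l)) = q"
      using l by (simp_all add: distinct_card)
    fix i j assume ij: "i \<in> set (take q l)" "j \<in> set (drop q l)"
    have "sorted (take q l @ drop q l)" "distinct (take q l @ drop q l)" using l by simp_all
    then have "i \<le> j" "i \<noteq> j" using ij unfolding sorted_append distinct_append by auto
    then show "i < j" by simp
  qed
qed

lemma obtain_min_on_finite:
  fixes g :: "'a \<Rightarrow> nat"
  assumes "finite A" "A \<noteq> {}"
  obtains v where "v \<in> A" "\<And>a. a \<in> A \<Longrightarrow> g v \<le> g a"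
proof
  show "arg_min_on g A \<in> A" using arg_min_if_finite[OF assms] by blast
  show "g (arg_min_on g A) \<le> g a" if "a \<in> A" for a
    by (rule arg_min_least) (use assms that in auto)
qed

lemma chain_has_common_subset:
  fixes X :: "'i \<Rightarrow> 'b set"
  assumes "finite I" "I \<noteq> {}" "\<And>i. i \<in> I \<Longrightarrow> finite (X i)"
    and "\<And>i j. i \<in> I \<Longrightarrow> j \<in> I \<Longrightarrow> X i \<subseteq> X j \<or> X j \<subseteq> X i"
  obtains m where "m \<in> I" "\<And>i. i \<in> I \<Longrightarrow> X m \<subseteq> X i"
proof -
  obtain m where m: "m \<in> I" "\<And>i. i \<in> I \<Longrightarrow> card (X m) \<le> card (X i)"
    using obtain_min_on_finite[OF assms(1,2), of "\<lambda>i. card (X i)"] by blast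
  have "X m \<subseteq> X i" if "i \<in> I" for i
    using m assms(3,4) that by (metis card_seteq subset_refl)
  with m that show ?thesis by blast
qed

lemma low_degree_vertex:
  assumes q: "q \<ge> 1"
  shows "\<exists>d. \<forall>(A :: 'a set) (B :: 'b set) R. finite A \<longrightarrow> finite B \<longrightarrow> A \<noteq> {} \<longrightarrow>
     \<not> has_P7 A B R \<longrightarrow> \<not> has_biclique q A B R \<longrightarrow>
     (\<exists>a\<in>A. card {b\<in>B. R a b} < d) \<or> (\<exists>b\<in>B. card {a\<in>A. R a b} < d)"
proof -
  obtain r where r: "\<And>(V :: nat set) E. finite V \<Longrightarrow> card V \<ge> r \<Longrightarrow>
      \<exists>I\<subseteq>V. card I = 2 * q \<and> clique I E \<or> card I = q \<and> indep I E"
    using ramsey2[of "2 * q" q] by metis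
  \<comment> \<open>Light vertices of \<open>A\<close> are adjacent to at most \<open>1 / M\<close> of \<open>S\<close>, so that \<open>M\<close> greedy choices are
    possible; \<open>M \<ge> 2\<close> leaves them at least half of their degree outside \<open>S\<close>.\<close>
  define M where "M = r + 2"
  define t where "t = 2 * M * q"
  \<comment> \<open>Degrees of at least \<open>d\<close> in \<open>A\<close> make \<open>S\<close> large enough for fewer than \<open>t\<close> heavy vertices, and in \<open>B\<close>
    leave each \<open>s\<close> a light neighbour, as \<open>d \<ge> t\<close>.\<close>
  define d where "d = t * 2 ^ t"
  have t1: "t \<ge> 1" "2 * q \<le> t" using q by (auto simp: t_def M_def)
  have d1: "d \<ge> t" by (simp add: d_def)
  have "(\<exists>a\<in>A. card {b\<in>B. R a b} < d) \<or> (\<exists>b\<in>B. card {a\<in>A. R a b} < d)"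
    if fin: "finite A" "finite B" and ne: "A \<noteq> {}"
      and free: "\<not> has_P7 A B R" "\<not> has_biclique q A B R"
    for A :: "'a set" and B :: "'b set" and R
  proof (rule ccontr)
    assume "\<not> ?thesis"
    then have degA: "\<And>a. a \<in> A \<Longrightarrow> d \<le> card {b\<in>B. R a b}"
      and degB: "\<And>b. b \<in> B \<Longrightarrow> d \<le> card {a\<in>A. R a b}"
      by (auto simp: not_less)
    obtain v where v: "v \<in> A" "\<And>a. a \<in> A \<Longrightarrow> card {b\<in>B. R v b} \<le> card {b\<in>B. R a b}"
      using obtain_min_on_finite[OF fin(1) ne, of "\<lambda>a. card {b\<in>B. R a b}"] by blast
    define S where "S = {b\<in>B. R v b}"
    have S: "finite S" "S \<subseteq> B" "card S \<ge> d" using fin degA[OF v(1)] by (auto simp: S_def)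
    then have Sne: "S \<noteq> {}" using d1 t1 by auto
    define H where "H = {w\<in>A. card S < M * card {s\<in>S. R w s}}"
    have H: "card H < t"
    proof (rule ccontr)
      assume "\<not> card H < t"
      then obtain T where T: "T \<subseteq> H" "card T = t"
        by (metis linorder_not_le obtain_subset_with_card_n)
      have "has_biclique q T S R"
        by (rule many_heavy_imp_biclique[OF S(1) _ T(2) t_def _ q])
          (use S T in \<open>auto simp: d_def H_def M_def\<close>)
      then have "has_biclique q A B R"
        by (rule has_biclique_mono) (use T S H_def in auto)
      with free show False by simp
    qed
    have "\<exists>w. w \<in> A \<and> R w s \<and> M * card {b\<in>S. R w b} \<le> card S" if "s \<in> S" for s
    proof -
      have "card H < card {a\<in>A. R a s}" using H d1 degB[of s] that S by auto
      then have "\<not> {a\<in>A. R a s} \<subseteq> H"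
        using fin card_mono[of H "{a\<in>A. R a s}"] by (auto simp: H_def)
      then show ?thesis by (auto simp: H_def not_less)
    qed
    then obtain w where w: "\<And>s. s \<in> S \<Longrightarrow> w s \<in> A" "\<And>s. s \<in> S \<Longrightarrow> R (w s) s"
      "\<And>s. s \<in> S \<Longrightarrow> M * card {b\<in>S. R (w s) b} \<le> card S" by metis
    have "\<exists>f :: nat \<Rightarrow> 'b. (\<forall>i<M. f i \<in> S) \<and> (\<forall>j<M. \<forall>i<j. f j \<notin> {b. R (w (f i)) b})"
      by (rule scattered_sequence[OF S(1) Sne _ order.refl])
        (use w(3) in \<open>simp add: Int_def conj_commute\<close>)
    then obtain s where s: "\<And>i. i < M \<Longrightarrow> s i \<in> S"
      "\<And>i j. j < M \<Longrightarrow> i < j \<Longrightarrow> \<not> R (w (s i)) (s j)" by auto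
    define W where "W = (\<lambda>i. w (s i))"
    have W: "W i \<in> A" "R (W i) (s i)" "M * card {b\<in>S. R (W i) b} \<le> card S" if "i < M" for i
      using s that w by (auto simp: W_def)
    have nonadj: "\<not> R (W i) (s j)" if "i < j" "j < M" for i j
      using s that by (auto simp: W_def)
    have "s i \<noteq> s j" "W i \<noteq> W j" if "i < j" "j < M" for i j
      using W(2)[of i] W(2)[of j] nonadj[OF that] that by auto
    then have inj_s: "inj_on s {..<M}" and inj_W: "inj_on W {..<M}"
      by (auto intro: linorder_inj_onI')
    \<comment> \<open>The choice excludes \<open>R (W i) (s j)\<close> only for \<open>i < j\<close>; Ramsey's theorem treats the converse
      pairs. A clique gives a half graph and hence a biclique, an independent set gives an
      induced matching.\<close>
    define E where "E = {{i, j} | i j. i < j \<and> R (W j) (s i)}"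
    obtain I where I: "I \<subseteq> {..<M}" "card I = 2 * q \<and> clique I E \<or> card I = q \<and> indep I E"
      using r[of "{..<M}" E] by (auto simp: M_def)
    from I(2) show False
    proof
      assume cl: "card I = 2 * q \<and> clique I E"
      then obtain L U where LU: "L \<subseteq> I" "U \<subseteq> I" "card L = q" "card U = q"
        "\<And>i j. i \<in> L \<Longrightarrow> j \<in> U \<Longrightarrow> i < j"
        using split_nat_set[of I q] q by metis
      have adj: "R (W j) (s i)" if "i \<in> L" "j \<in> U" for i j
      proof -
        have "i < j" "i \<in> I" "j \<in> I" using that LU by auto
        then have "{i, j} \<in> E" using cl by (auto simp: clique_def)
        with \<open>i < j\<close> show ?thesis by (auto simp: E_def doubleton_eq_iff)
      qed
      have "L \<subseteq> {..<M}" "U \<subseteq> {..<M}" using LU I by auto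
      moreover have "s i \<in> B" if "i < M" for i using s S that by blast
      ultimately have "card (W ` U) = q" "card (s ` L) = q" "W ` U \<subseteq> A" "s ` L \<subseteq> B"
        using LU(3,4) W(1) inj_on_subset[OF inj_W] inj_on_subset[OF inj_s]
        by (auto simp: card_image)
      then have "has_biclique q A B R"
        by (intro has_bicliqueI[of "W ` U" _ "s ` L"]) (use adj in auto)
      with free show False by simp
    next
      assume ind: "card I = q \<and> indep I E"
      have matching: "\<not> R (W i) (s j)" if "i \<in> I" "j \<in> I" "i \<noteq> j" for i j
      proof (cases "i < j")
        case True
        then show ?thesis using nonadj I that by auto
      next
        case False
        then have "j < i" using that by simp
        moreover have "{j, i} \<notin> E" using that ind by (auto simp: indep_def)
        ultimately show ?thesis by (auto simp: E_def)
      qed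
      define X where "X = (\<lambda>i. {b\<in>B. R (W i) b \<and> \<not> R v b})"
      have finX: "finite (X i)" for i using fin by (simp add: X_def)
      have cX: "q \<le> card (X i)" if "i \<in> I" for i
      proof -
        have iM: "i < M" using that I by auto
        have "{b\<in>B. R (W i) b} = {b\<in>S. R (W i) b} \<union> X i" by (auto simp: S_def X_def)
        then have "card {b\<in>B. R (W i) b} \<le> card {b\<in>S. R (W i) b} + card (X i)"
          by (metis card_Un_le)
        moreover have "card S \<le> card {b\<in>B. R (W i) b}" using v(2) W iM by (simp add: S_def)
        moreover have "2 * card {b\<in>S. R (W i) b} \<le> card S"
          using W(3)[OF iM] by (simp add: M_def algebra_simps)
        ultimately show ?thesis using S(3) d1 t1 by linarith
      qed
      have "X i \<subseteq> X j \<or> X j \<subseteq> X i" if ij: "i \<in> I" "j \<in> I" for i j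
      proof (rule ccontr)
        assume "\<not> ?thesis"
        then obtain x1 x2 where x: "x1 \<in> X i" "x1 \<notin> X j" "x2 \<in> X j" "x2 \<notin> X i" by auto
        then have "i \<noteq> j" by auto
        have iM: "i < M" "j < M" using ij I by auto
        have "induces_P7 A B R (W i) v (W j) x1 (s i) (s j) x2"
          using x matching ij \<open>i \<noteq> j\<close> iM W s v(1) by (simp add: induces_P7_def X_def S_def)
        then have "has_P7 A B R" unfolding has_P7_def by (intro exI)
        with free show False by simp
      qed
      moreover have "finite I" "I \<noteq> {}" using ind q I finite_subset by auto
      ultimately obtain m where m: "m \<in> I" "\<And>i. i \<in> I \<Longrightarrow> X m \<subseteq> X i"
        using chain_has_common_subset[of I X] finX by metis
      have "card (W ` I) = q" using ind I inj_W by (auto simp: card_image inj_on_subset)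
      then have "has_biclique q A B R"
        by (intro has_bicliqueI[of "W ` I" _ "X m"])
          (use cX m W I in \<open>auto simp: X_def subset_iff\<close>)
      with free show False by simp
    qed
  qed
  then show ?thesis by (intro exI[of _ d] allI impI)
qed

section \<open>Linearly many edges or linearly many non-edges\<close>

definition pairs_of :: "'a set \<Rightarrow> 'b set \<Rightarrow> ('a \<Rightarrow> 'b \<Rightarrow> bool) \<Rightarrow> ('a \<times> 'b) set" where
  "pairs_of A B R = {(a, b). a \<in> A \<and> b \<in> B \<and> R a b}"

lemma finite_pairs_of: "finite A \<Longrightarrow> finite B \<Longrightarrow> finite (pairs_of A B R)"
  by (rule finite_subset[of _ "A \<times> B"]) (auto simp: pairs_of_def)

lemma linear_number_of_pairs:
  assumes q: "q \<ge> 1"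
  shows "\<exists>d. \<forall>(A :: 'a set) (B :: 'b set) R. finite A \<longrightarrow> finite B \<longrightarrow>
     \<not> has_P7 A B R \<longrightarrow> \<not> has_biclique q A B R \<longrightarrow>
     card (pairs_of A B R) \<le> d * (card A + card B)"
proof -
  from low_degree_vertex[OF q] obtain d where d: "\<forall>(A :: 'a set) (B :: 'b set) R. finite A \<longrightarrow> finite B \<longrightarrow> A \<noteq> {} \<longrightarrow>
     \<not> has_P7 A B R \<longrightarrow> \<not> has_biclique q A B R \<longrightarrow>
     (\<exists>a\<in>A. card {b\<in>B. R a b} < d) \<or> (\<exists>b\<in>B. card {a\<in>A. R a b} < d)" ..
  have "card (pairs_of A B R) \<le> d * (card A + card B)"
    if "finite A" "finite B" "\<not> has_P7 A B R" "\<not> has_biclique q A B R"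
    for A :: "'a set" and B :: "'b set" and R
    using that
  proof (induction "card A + card B" arbitrary: A B rule: less_induct)
    case less
    note fin = less.prems(1,2)
    have IH: "card (pairs_of A' B' R) \<le> d * (card A' + card B')"
      if sub: "A' \<subseteq> A" "B' \<subseteq> B" and lt: "card A' + card B' < card A + card B" for A' B'
    proof (rule less.hyps[OF lt])
      show "finite A'" "finite B'" using fin sub finite_subset by auto
      show "\<not> has_P7 A' B' R" using less.prems(3) has_P7_mono sub by blast
      show "\<not> has_biclique q A' B' R" using less.prems(4) has_biclique_mono sub by blast
    qed
    show ?case
    proof (cases "A = {}")
      case True
      then show ?thesis by (simp add: pairs_of_def)
    next
      case False
      from d[rule_format, OF fin False less.prems(3,4)] show ?thesis
      proof (elim disjE bexE)
        fix a assume a: "a \<in> A" "card {b\<in>B. R a b} < d"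
        have "pairs_of A B R = pairs_of (A - {a}) B R \<union> Pair a ` {b\<in>B. R a b}"
          using a by (auto simp: pairs_of_def)
        then have "card (pairs_of A B R) \<le>
            card (pairs_of (A - {a}) B R) + card (Pair a ` {b\<in>B. R a b})"
          by (metis card_Un_le)
        also have "card (Pair a ` {b\<in>B. R a b}) \<le> d"
          using a(2) by (simp add: card_image inj_on_def)
        also have "card (pairs_of (A - {a}) B R) \<le> d * (card (A - {a}) + card B)"
          by (rule IH) (use card_Diff1_less[OF fin(1) a(1)] in auto)
        also have "card A = Suc (card (A - {a}))" by (rule card.remove[OF fin(1) a(1)])
        ultimately show ?thesis by simp
      next
        fix b assume b: "b \<in> B" "card {a\<in>A. R a b} < d"
        have "pairs_of A B R = pairs_of A (B - {b}) R \<union> (\<lambda>a. (a, b)) ` {a\<in>A. R a b}"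
          using b by (auto simp: pairs_of_def)
        then have "card (pairs_of A B R) \<le>
            card (pairs_of A (B - {b}) R) + card ((\<lambda>a. (a, b)) ` {a\<in>A. R a b})"
          by (metis card_Un_le)
        also have "card ((\<lambda>a. (a, b)) ` {a\<in>A. R a b}) \<le> d"
          using b(2) by (simp add: card_image inj_on_def)
        also have "card (pairs_of A (B - {b}) R) \<le> d * (card A + card (B - {b}))"
          by (rule IH) (use card_Diff1_less[OF fin(2) b(1)] in auto)
        also have "card B = Suc (card (B - {b}))" by (rule card.remove[OF fin(2) b(1)])
        ultimately show ?thesis by simp
      qed
    qed
  qed
  then show ?thesis by (intro exI[of _ d] allI impI)
qed

text \<open>The bit \<open>h\<close> selects the adjacency relation itself or its bipartite complement, whichever has
  no large biclique.\<close>

lemma sparse_or_cosparse: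
  assumes p: "p \<ge> 1"
  shows "\<exists>d. \<forall>(A :: 'a set) (B :: 'b set) R. finite A \<longrightarrow> finite B \<longrightarrow>
     \<not> has_P7 A B R \<longrightarrow> \<not> has_biclique_plus_isolated p A B R \<longrightarrow>
     \<not> has_biclique_plus_isolated p B A (\<lambda>b a. R a b) \<longrightarrow>
     (\<exists>h. card (pairs_of A B (\<lambda>a b. R a b = h)) \<le> d * (card A + card B))"
proof -
  define q where "q = p * 4 ^ (p + 1)"
  have "q \<ge> 1" using p by (simp add: q_def)
  from linear_number_of_pairs[OF this] obtain d where
    d: "\<forall>(A :: 'a set) (B :: 'b set) R. finite A \<longrightarrow> finite B \<longrightarrow>
     \<not> has_P7 A B R \<longrightarrow> \<not> has_biclique q A B R \<longrightarrow>
     card (pairs_of A B R) \<le> d * (card A + card B)" ..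
  have "\<exists>h. card (pairs_of A B (\<lambda>a b. R a b = h)) \<le> d * (card A + card B)"
    if "finite A" "finite B" "\<not> has_P7 A B R" "\<not> has_biclique_plus_isolated p A B R"
      "\<not> has_biclique_plus_isolated p B A (\<lambda>b a. R a b)"
    for A :: "'a set" and B :: "'b set" and R
    using biclique_dichotomy[OF p that(4,5)] unfolding q_def[symmetric]
  proof
    assume "\<not> has_biclique q A B R"
    from d[rule_format, OF that(1-3) this] show ?thesis by (intro exI[of _ True]) simp
  next
    assume "\<not> has_biclique q A B (\<lambda>a b. \<not> R a b)"
    moreover have "\<not> has_P7 A B (\<lambda>a b. \<not> R a b)" using that(3) has_P7_complement by blast
    ultimately show ?thesis using d[rule_format, OF that(1,2)] by (intro exI[of _ False]) simp
  qed
  then show ?thesis by (intro exI[of _ d] allI impI)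
qed

section \<open>From induced subgraphs to adjacency relations\<close>

text \<open>Adjacency needs to be checked only across the parts, and \<open>U\<close>, \<open>V\<close> cover both ways of mapping
  the parts of \<open>H\<close>.\<close>

lemma contains_inducedI:
  assumes G: "bipartite_graph G"
    and UV: "(U = lpart G \<and> V = rpart G) \<or> (U = rpart G \<and> V = lpart G)"
    and H: "independent H (lpart H)" "independent H (rpart H)"
    and f: "inj_on f (lpart H)" "inj_on f (rpart H)" "f ` lpart H \<subseteq> U" "f ` rpart H \<subseteq> V"
    and adj: "\<And>u v. u \<in> lpart H \<Longrightarrow> v \<in> rpart H \<Longrightarrow> {f u, f v} \<in> edges G \<longleftrightarrow> {u, v} \<in> edges H"
  shows "contains_induced G H"
proof -
  have disj: "U \<inter> V = {}" and ind: "independent G U" "independent G V"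
    using G UV by (auto simp: bipartite_graph_def)
  have "inj_on f (verts H)"
    unfolding verts_def using f disj by (subst inj_on_Un) auto
  moreover have "f ` verts H \<subseteq> verts G"
    using f UV by (auto simp: verts_def)
  moreover have "{f u, f v} \<in> edges G \<longleftrightarrow> {u, v} \<in> edges H"
    if uv: "u \<in> verts H" "v \<in> verts H" for u v
  proof -
    consider "u \<in> lpart H" "v \<in> lpart H" | "u \<in> rpart H" "v \<in> rpart H"
      | "u \<in> lpart H" "v \<in> rpart H" | "u \<in> rpart H" "v \<in> lpart H"
      using uv unfolding verts_def by blast
    then show ?thesis
    proof cases
      case 1
      then show ?thesis using H ind f unfolding independent_def by blast
    next
      case 2
      then show ?thesis using H ind f unfolding independent_def by blast
    next
      case 3
      then show ?thesis by (rule adj)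
    next
      case 4
      then show ?thesis using adj[of v u] by (simp add: insert_commute)
    qed
  qed
  moreover have "f ` lpart H \<subseteq> lpart G \<and> f ` rpart H \<subseteq> rpart G \<or>
      f ` lpart H \<subseteq> rpart G \<and> f ` rpart H \<subseteq> lpart G"
    using UV f by auto
  ultimately show ?thesis
    unfolding contains_induced_def by (intro exI[of _ f] conjI ballI) simp_all
qed

lemma has_P7_imp_contains_path:
  assumes G: "bipartite_graph G" and P: "has_P7 (lpart G) (rpart G) (\<lambda>a b. {a, b} \<in> edges G)"
  shows "contains_induced G (path_bigraph 7)"
proof -
  from P obtain w1 v w2 x1 s1 s2 x2 where
    *: "induces_P7 (lpart G) (rpart G) (\<lambda>a b. {a, b} \<in> edges G) w1 v w2 x1 s1 s2 x2"
    unfolding has_P7_def by (elim exE) (rule that)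
  note * = *[unfolded induces_P7_def]
  have dist: "w1 \<noteq> v" "w1 \<noteq> w2" "v \<noteq> w2" "x1 \<noteq> s1" "x1 \<noteq> s2" "x1 \<noteq> x2" "s1 \<noteq> s2" "s1 \<noteq> x2" "s2 \<noteq> x2"
    using * by auto
  have parts: "lpart (path_bigraph 7) = {0, 2, 4, 6}" "rpart (path_bigraph 7) = {1, 3, 5}"
    unfolding path_bigraph_def set_eq_iff by (simp_all, presburger+)
  have edge: "{i, j} \<in> edges (path_bigraph 7) \<longleftrightarrow> i < 7 \<and> j < 7 \<and> (j = Suc i \<or> i = Suc j)" for i j
    by (auto simp: path_bigraph_def doubleton_eq_iff)
  define f where "f = (\<lambda>i. [x1, w1, s1, v, s2, w2, x2] ! i)"
  have f: "f 0 = x1" "f 1 = w1" "f 2 = s1" "f 3 = v" "f 4 = s2" "f 5 = w2" "f 6 = x2"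
    by (simp_all add: f_def numeral_eq_Suc)
  \<comment> \<open>The even vertices of the path are the four that lie in \<open>rpart G\<close>, hence the swapped parts.\<close>
  show ?thesis
  proof (rule contains_inducedI[OF G, of "rpart G" "lpart G"])
    show "independent (path_bigraph 7) (lpart (path_bigraph 7))"
      "independent (path_bigraph 7) (rpart (path_bigraph 7))"
      unfolding independent_def edge by (auto simp: path_bigraph_def)
    show "inj_on f (lpart (path_bigraph 7))" "inj_on f (rpart (path_bigraph 7))"
      unfolding parts using dist by (simp_all add: f del: One_nat_def)
    show "f ` lpart (path_bigraph 7) \<subseteq> rpart G" "f ` rpart (path_bigraph 7) \<subseteq> lpart G"
      unfolding parts using * by (simp_all add: f del: One_nat_def)
    fix i j assume "i \<in> lpart (path_bigraph 7)" "j \<in> rpart (path_bigraph 7)"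
    then have "i \<in> {0, 2, 4, 6}" "j \<in> {1, 3, 5}" unfolding parts by auto
    then show "{f i, f j} \<in> edges G \<longleftrightarrow> {i, j} \<in> edges (path_bigraph 7)"
      unfolding edge using * by (elim insertE) (simp_all add: f insert_commute del: One_nat_def)
  qed simp
qed

lemma has_biclique_plus_isolated_imp_contains:
  assumes G: "bipartite_graph G" and p: "p \<ge> 1"
    and UV: "(U = lpart G \<and> V = rpart G) \<or> (U = rpart G \<and> V = lpart G)"
    and P: "has_biclique_plus_isolated p U V (\<lambda>a b. {a, b} \<in> edges G)"
  shows "contains_induced G (Kpp_plus_O0p p)"
proof -
  from P obtain X Y Z where
    sub: "X \<subseteq> U" "Y \<subseteq> V" "Z \<subseteq> V" and c: "card X = p" "card Y = p" "card Z = p"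
    and XYZ: "\<forall>x\<in>X. \<forall>y\<in>Y. {x, y} \<in> edges G" "\<forall>x\<in>X. \<forall>z\<in>Z. {x, z} \<notin> edges G"
    unfolding has_biclique_plus_isolated_def by (elim exE conjE) (rule that)
  have adj: "{x, y} \<in> edges G" "{x, z} \<notin> edges G" if "x \<in> X" "y \<in> Y" "z \<in> Z" for x y z
    using XYZ that by blast+
  have "finite X" "finite Y" "finite Z" using c p by (auto intro: card_ge_0_finite)
  then obtain x y z where bij: "bij_betw x {0..<p} X" "bij_betw y {0..<p} Y" "bij_betw z {0..<p} Z"
    using ex_bij_betw_nat_finite c by metis
  have "X \<noteq> {}" using c p by auto
  then have YZ: "Y \<inter> Z = {}" using adj by blast
  define f where "f = (\<lambda>i. if i < p then x i else if i < 2 * p then y (i - p) else z (i - 2 * p))"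
  let ?H = "Kpp_plus_O0p p"
  have im: "x i \<in> X" "y i \<in> Y" "z i \<in> Z" if "i < p" for i
    using bij that by (auto simp: bij_betw_def)
  have inj: "inj_on x {0..<p}" "inj_on y {0..<p}" "inj_on z {0..<p}"
    using bij by (auto simp: bij_betw_def)
  have eq: "x i = x j \<longleftrightarrow> i = j" "y i = y j \<longleftrightarrow> i = j" "z i = z j \<longleftrightarrow> i = j"
    if "i < p" "j < p" for i j
    using inj[THEN inj_on_eq_iff, of i j] that by simp_all
  have neq: "y i \<noteq> z j" "z j \<noteq> y i" if "i < p" "j < p" for i j
    using YZ im(2)[OF that(1)] im(3)[OF that(2)] by auto
  have edge: "{i, j} \<in> edges ?H \<longleftrightarrow> i < p \<and> p \<le> j \<and> j < 2 * p \<or> j < p \<and> p \<le> i \<and> i < 2 * p" for i j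
    by (auto simp: Kpp_plus_O0p_def doubleton_eq_iff)
  have parts: "lpart ?H = {0..<p}" "rpart ?H = {p..<3 * p}" by (auto simp: Kpp_plus_O0p_def)
  have fl: "f i = x i" if "i < p" for i using that by (simp add: f_def)
  have fr: "f i = (if i < 2 * p then y (i - p) else z (i - 2 * p))" if "p \<le> i" for i
    using that by (simp add: f_def)
  have rng: "i - p < p" if "p \<le> i" "i < 2 * p" for i using that by simp
  have rng': "i - 2 * p < p" if "\<not> i < 2 * p" "i < 3 * p" for i using that by simp
  show ?thesis
  proof (rule contains_inducedI[OF G UV])
    show "independent ?H (lpart ?H)" "independent ?H (rpart ?H)"
      unfolding independent_def edge parts by auto
    show "inj_on f (lpart ?H)" unfolding parts by (auto simp: inj_on_def fl eq)
    show "inj_on f (rpart ?H)"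
    proof (rule inj_onI)
      fix i j assume ij: "i \<in> rpart ?H" "j \<in> rpart ?H" and "f i = f j"
      then show "i = j"
        unfolding parts using rng[of i] rng[of j] rng'[of i] rng'[of j]
        by (auto simp: fr eq neq split: if_splits)
    qed
    show "f ` lpart ?H \<subseteq> U" unfolding parts using im sub by (auto simp: fl)
    show "f ` rpart ?H \<subseteq> V"
    proof
      fix w assume "w \<in> f ` rpart ?H"
      then obtain i where i: "p \<le> i" "i < 3 * p" "w = f i" unfolding parts by auto
      then show "w \<in> V"
        using im(2)[OF rng[of i]] im(3)[OF rng'[of i]] sub by (auto simp: fr)
    qed
    fix i j assume "i \<in> lpart ?H" "j \<in> rpart ?H"
    then have i: "i < p" and j: "p \<le> j" "j < 3 * p" unfolding parts by auto
    show "{f i, f j} \<in> edges G \<longleftrightarrow> {i, j} \<in> edges ?H"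
    proof (cases "j < 2 * p")
      case True
      then show ?thesis
        unfolding edge using i j adj(1)[OF im(1)[OF i] im(2)[OF rng[of j]] im(3)[OF i]] by (simp add: fl fr)
    next
      case False
      then show ?thesis
        unfolding edge using i j adj(2)[OF im(1)[OF i] im(2)[OF i] im(3)[OF rng'[of j]]] by (simp add: fl fr)
    qed
  qed
qed

lemma bipartite_graph_induced_subgraph:
  "bipartite_graph G \<Longrightarrow> bipartite_graph (induced_subgraph G S)"
  unfolding bipartite_graph_def induced_subgraph_def verts_def independent_def
  by (auto intro: finite_subset)

lemma contains_induced_of_induced_subgraph:
  assumes "contains_induced (induced_subgraph G S) H"
  shows "contains_induced G H"
proof -
  from assms obtain f where f: "inj_on f (verts H)" "f ` verts H \<subseteq> verts (induced_subgraph G S)"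
    "\<forall>u\<in>verts H. \<forall>v\<in>verts H.
      {f u, f v} \<in> edges (induced_subgraph G S) \<longleftrightarrow> {u, v} \<in> edges H"
    "f ` lpart H \<subseteq> lpart (induced_subgraph G S) \<and> f ` rpart H \<subseteq> rpart (induced_subgraph G S) \<or>
      f ` lpart H \<subseteq> rpart (induced_subgraph G S) \<and> f ` rpart H \<subseteq> lpart (induced_subgraph G S)"
    unfolding contains_induced_def by (elim exE conjE) (rule that)
  have V: "f ` verts H \<subseteq> verts G \<inter> S"
    using f(2) by (auto simp: verts_def induced_subgraph_def)
  have "{f u, f v} \<in> edges G \<longleftrightarrow> {u, v} \<in> edges H" if "u \<in> verts H" "v \<in> verts H" for u v
    using f(3)[rule_format, OF that] V that by (auto simp: induced_subgraph_def)
  moreover have "f ` lpart H \<subseteq> lpart G \<and> f ` rpart H \<subseteq> rpart G \<or>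
      f ` lpart H \<subseteq> rpart G \<and> f ` rpart H \<subseteq> lpart G"
    using f(4) by (auto simp: induced_subgraph_def)
  ultimately show ?thesis
    unfolding contains_induced_def using f(1) V by (intro exI[of _ f] conjI ballI) simp_all
qed

lemma hereditary_free_class: "hereditary (free_class H1 H2)"
  unfolding hereditary_def
proof (intro ballI allI impI)
  fix G S assume "G \<in> free_class H1 H2"
  then show "induced_subgraph G S \<in> free_class H1 H2"
    using bipartite_graph_induced_subgraph[of G S] contains_induced_of_induced_subgraph[of G S H1]
      contains_induced_of_induced_subgraph[of G S H2]
    unfolding free_class_def by blast
qed

section \<open>Counting\<close>

text \<open>A nonempty set of size at most \<open>Suc m\<close> arises by inserting one element into a set of size at
  most \<open>m\<close>.\<close>

lemma card_small_subsets:
  assumes U: "finite U"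
  shows "card {E. E \<subseteq> U \<and> card E \<le> m} \<le> (card U + 1) ^ m"
proof (induction m)
  case 0
  have "{E. E \<subseteq> U \<and> card E \<le> 0} = {{}}" using U finite_subset by fastforce
  then show ?case by simp
next
  case (Suc m)
  let ?F = "\<lambda>m. {E. E \<subseteq> U \<and> card E \<le> m}"
  let ?g = "\<lambda>(c, E). case c of None \<Rightarrow> E | Some e \<Rightarrow> insert e E"
  have finF: "finite (?F m)" for m using U by simp
  have "?F (Suc m) \<subseteq> ?g ` (insert None (Some ` U) \<times> ?F m)"
  proof
    fix E assume E: "E \<in> ?F (Suc m)"
    show "E \<in> ?g ` (insert None (Some ` U) \<times> ?F m)"
    proof (cases "E = {}")
      case True
      then show ?thesis by (intro image_eqI[of _ _ "(None, {})"]) auto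
    next
      case False
      then obtain e where e: "e \<in> E" by auto
      have "finite E" using E U finite_subset by auto
      then have "card (E - {e}) \<le> m" using E e by (auto simp: card_Diff_singleton)
      then show ?thesis using E e by (intro image_eqI[of _ _ "(Some e, E - {e})"]) auto
    qed
  qed
  then have "card (?F (Suc m)) \<le> card (insert None (Some ` U) \<times> ?F m)"
    using U finF by (meson card_mono card_image_le finite_SigmaI finite_imageI finite_insert le_trans)
  also have "\<dots> = (card U + 1) * card (?F m)"
    using U by (simp add: card_cartesian_product card_image)
  also have "\<dots> \<le> (card U + 1) * (card U + 1) ^ m" using Suc by (rule mult_left_mono) simp
  finally show ?case by simp
qed

lemma edges_bipartite_graph:
  assumes "bipartite_graph G"
  shows "edges G = {{a, b} | a b. a \<in> lpart G \<and> b \<in> rpart G \<and> {a, b} \<in> edges G}"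
proof (intro subset_antisym subsetI)
  fix e assume e: "e \<in> edges G"
  then have "e \<subseteq> verts G" "card e = 2" using assms by (auto simp: bipartite_graph_def)
  then obtain u v where uv: "e = {u, v}" "u \<in> verts G" "v \<in> verts G" by (auto simp: card_2_iff)
  have "\<not> (u \<in> lpart G \<and> v \<in> lpart G)" "\<not> (u \<in> rpart G \<and> v \<in> rpart G)"
    using assms e uv by (auto simp: bipartite_graph_def independent_def)
  then consider "u \<in> lpart G" "v \<in> rpart G" | "v \<in> lpart G" "u \<in> rpart G"
    using uv by (auto simp: verts_def)
  then show "e \<in> {{a, b} | a b. a \<in> lpart G \<and> b \<in> rpart G \<and> {a, b} \<in> edges G}"
  proof cases
    case 1
    then show ?thesis using e uv(1) by blast
  next
    case 2
    moreover have "e = {v, u}" using uv(1) by auto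
    ultimately show ?thesis using e by blast
  qed
qed auto

text \<open>A graph is recovered from its left part (\<open>2 ^ n\<close> choices), the bit \<open>h\<close> telling whether the edges
  or the non-edges are listed, and the list itself.\<close>

lemma card_labelled_sparse_or_cosparse:
  assumes X: "\<And>G. G \<in> labelled_graphs X n \<Longrightarrow> bipartite_graph G \<and>
      (\<exists>h. card (pairs_of (lpart G) (rpart G) (\<lambda>a b. ({a, b} \<in> edges G) = h)) \<le> m)"
  shows "card (labelled_graphs X n) \<le> 2 ^ n * (2 * (n ^ 2 + 1) ^ m)"
proof -
  let ?V = "{1..n}"
  define decode where "decode = (\<lambda>(A, h, E). \<lparr>lpart = A, rpart = ?V - A,
      edges = {{a, b} | a b. a \<in> A \<and> b \<in> ?V - A \<and> ((a, b) \<in> E) = h}\<rparr>)"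
  let ?C = "Pow ?V \<times> (UNIV :: bool set) \<times> {E. E \<subseteq> ?V \<times> ?V \<and> card E \<le> m}"
  have finC: "finite ?C" by simp
  have "labelled_graphs X n \<subseteq> decode ` ?C"
  proof
    fix G assume G: "G \<in> labelled_graphs X n"
    then have V: "lpart G \<union> rpart G = ?V" by (simp add: labelled_graphs_def verts_def)
    from X[OF G] obtain h where bip: "bipartite_graph G" and
      h: "card (pairs_of (lpart G) (rpart G) (\<lambda>a b. ({a, b} \<in> edges G) = h)) \<le> m" by auto
    define E where "E = pairs_of (lpart G) (rpart G) (\<lambda>a b. ({a, b} \<in> edges G) = h)"
    have r: "rpart G = ?V - lpart G" using V bip by (auto simp: bipartite_graph_def)
    have "{{a, b} | a b. a \<in> lpart G \<and> b \<in> rpart G \<and> ((a, b) \<in> E) = h} =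
        {{a, b} | a b. a \<in> lpart G \<and> b \<in> rpart G \<and> {a, b} \<in> edges G}"
      by (cases h) (auto simp: E_def pairs_of_def)
    then have "G = decode (lpart G, h, E)"
      using edges_bipartite_graph[OF bip] r by (simp add: decode_def)
    moreover have "(lpart G, h, E) \<in> ?C"
      using V h by (auto simp: E_def pairs_of_def)
    ultimately show "G \<in> decode ` ?C" by (rule image_eqI)
  qed
  then have "card (labelled_graphs X n) \<le> card ?C"
    using finC by (meson card_image_le card_mono finite_imageI le_trans)
  also have "\<dots> = 2 ^ n * (2 * card {E. E \<subseteq> ?V \<times> ?V \<and> card E \<le> m})"
    by (simp add: card_cartesian_product card_Pow)
  also have "\<dots> \<le> 2 ^ n * (2 * (n ^ 2 + 1) ^ m)"
    using card_small_subsets[of "?V \<times> ?V" m] by (simp add: card_cartesian_product power2_eq_square)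
  finally show ?thesis .
qed

theorem theorem11:
  fixes p :: nat
  assumes "p \<ge> 1"
  shows "at_most_factorial (free_class (path_bigraph 7) (Kpp_plus_O0p p))"
proof -
  let ?X = "free_class (path_bigraph 7) (Kpp_plus_O0p p) :: nat bigraph set"
  from sparse_or_cosparse[OF assms] obtain d where
    d: "\<forall>(A :: nat set) (B :: nat set) R. finite A \<longrightarrow> finite B \<longrightarrow>
     \<not> has_P7 A B R \<longrightarrow> \<not> has_biclique_plus_isolated p A B R \<longrightarrow>
     \<not> has_biclique_plus_isolated p B A (\<lambda>b a. R a b) \<longrightarrow>
     (\<exists>h. card (pairs_of A B (\<lambda>a b. R a b = h)) \<le> d * (card A + card B))" ..
  have sparse: "bipartite_graph G \<and>
      (\<exists>h. card (pairs_of (lpart G) (rpart G) (\<lambda>a b. ({a, b} \<in> edges G) = h)) \<le> d * n)"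
    if G: "G \<in> labelled_graphs ?X n" for G n
  proof -
    from G have bip: "bipartite_graph G" and V: "lpart G \<union> rpart G = {1..n}"
      and free: "\<not> contains_induced G (path_bigraph 7)" "\<not> contains_induced G (Kpp_plus_O0p p)"
      by (auto simp: labelled_graphs_def free_class_def verts_def)
    have fin: "finite (lpart G)" "finite (rpart G)" and "lpart G \<inter> rpart G = {}"
      using bip by (auto simp: bipartite_graph_def verts_def)
    then have size: "card (lpart G) + card (rpart G) = n"
      using V card_Un_disjoint[of "lpart G" "rpart G"] by simp
    have no_P7: "\<not> has_P7 (lpart G) (rpart G) (\<lambda>a b. {a, b} \<in> edges G)"
      using has_P7_imp_contains_path[OF bip] free by blast
    have no_Kpp: "\<not> has_biclique_plus_isolated p (lpart G) (rpart G) (\<lambda>a b. {a, b} \<in> edges G)"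
      "\<not> has_biclique_plus_isolated p (rpart G) (lpart G) (\<lambda>b a. {a, b} \<in> edges G)"
      using has_biclique_plus_isolated_imp_contains[OF bip assms, of "lpart G" "rpart G"]
        has_biclique_plus_isolated_imp_contains[OF bip assms, of "rpart G" "lpart G"] free
      by (auto simp: insert_commute)
    show ?thesis using bip d[rule_format, OF fin no_P7 no_Kpp] unfolding size by simp
  qed
  define f :: "nat \<Rightarrow> real" where
    "f = (\<lambda>n. (1 + real n) + real d * (real n * log 2 (real n ^ 2 + 1)))"
  have "(\<lambda>n. real n * log 2 (real n ^ 2 + 1)) \<in> O(\<lambda>n. real n * ln (real n))" by real_asymp
  then have "(\<lambda>n. real d * (real n * log 2 (real n ^ 2 + 1))) \<in> O(\<lambda>n. real n * ln (real n))"
    by (cases "d = 0") simp_all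
  moreover have "(\<lambda>n. 1 + real n) \<in> O(\<lambda>n. real n * ln (real n))" by real_asymp
  ultimately have "f \<in> O(\<lambda>n. real n * ln (real n))"
    unfolding f_def by (rule sum_in_bigo(1)[rotated])
  moreover have "real (card (labelled_graphs ?X n)) \<le> 2 powr f n" for n
  proof -
    have "card (labelled_graphs ?X n) \<le> 2 ^ n * (2 * (n ^ 2 + 1) ^ (d * n))"
      using card_labelled_sparse_or_cosparse sparse by blast
    then have "real (card (labelled_graphs ?X n)) \<le> real (2 ^ n * (2 * (n ^ 2 + 1) ^ (d * n)))"
      by (rule of_nat_mono)
    also have "\<dots> = 2 powr f n"
    proof -
      have pos: "real n ^ 2 + 1 > 0" by (simp add: add_nonneg_pos)
      have "2 powr (real d * (real n * log 2 (real n ^ 2 + 1))) =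
          (2 powr log 2 (real n ^ 2 + 1)) powr real (d * n)"
        by (simp add: powr_powr mult_ac)
      also have "\<dots> = (real n ^ 2 + 1) ^ (d * n)"
        using pos by (simp add: powr_realpow del: of_nat_mult)
      finally show ?thesis by (simp add: f_def powr_add powr_realpow add.commute)
    qed
    finally show ?thesis .
  qed
  ultimately show ?thesis
    unfolding at_most_factorial_def using hereditary_free_class by blast
qed

end
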